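(* Let $q$ be a prime power, let $n,m,k$ be integers with $1<k<n$ and $m<n\le km$, and let $\lambda\in\mathbb{F}_{q^m}$ with $\mathbb{F}_q(\lambda)=\mathbb{F}_{q^m}$. Let $t=\lfloor (km-n)/m\rfloor$, $a=n-(k-t-2)m$ and $h=\max\{\lfloor a/2^{t+1}\rfloor,1\}$. Define a tuple $\mathbf n$ as follows. If $a\ge t+2$: let $H=\{i\in\mathbb{Z}_{\ge0}:(a-i)/2^{t+1-i}\ge1\}$ and $z=\min H$. If $z=0$, let $(m_1,\dots,m_{t+2})=\Psi(a,t+2)$ and $\mathbf n=(m,\dots,m,m_1,\dots,m_{t+2})$ with $k-t-2$ leading entries equal to $m$. If $z>0$, let $(m_1,\dots,m_{t-z+2})=\Psi(a-z,t-z+2)$ and $\mathbf n=(m,\dots,m,m_1,\dots,m_{t-z+2},1,\dots,1)$ with $k-t-2$ leading entries equal to $m$ and $z$ trailing ones. If $a<t+2$: let $\beta=\lfloor (n-k)/(m-1)\rfloor$, $\gamma=(n-k)-(m-1)\beta$, and $\mathbf n=(m,\dots,m,\gamma+1,1,\dots,1)$ with $\beta$ entries equal to $m$ followed by $\gamma+1$ and then $k-\beta-1$ ones. Then $\mathcal C_{\lambda,\mathbf n}$ is an $[n,k]_{q^m/q}$ code with $\mathrm{WS}(\mathcal C_{\lambda,\mathbf n})=\{h,h+1,\dots,m\}$; in particular it has exactly $m-h+1$ distinct nonzero weights.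
   Context: $\mathbb{F}_{q^m}$ is the degree-$m$ extension of $\mathbb{F}_q$. Rank weight of $\mathbf v=(v_1,\dots,v_n)\in\mathbb{F}_{q^m}^n$: $\mathrm{w}(\mathbf v)=\dim_{\mathbb{F}_q}\langle v_1,\dots,v_n\rangle_{\mathbb{F}_q}$. An $[n,k]_{q^m/q}$ code is a $k$-dimensional $\mathbb{F}_{q^m}$-subspace $\mathcal C\subseteq\mathbb{F}_{q^m}^n$, with weight spectrum $\mathrm{WS}(\mathcal C)=\{\mathrm{w}(\mathbf c):\mathbf c\in\mathcal C\setminus\{\mathbf 0\}\}$. For integers $u\ge v\ge 2$, $\Psi(u,v):=(u_1,\dots,u_v)$ with $u_1=\lceil u/2\rceil$, $u_i=\lceil\lfloor u/2^{i-1}\rfloor/2\rceil$ for $2\le i\le v-1$, $u_v=\lfloor u/2^{v-1}\rfloor$. $\mathbf u_{\lambda,\ell}=(1,\lambda,\dots,\lambda^{\ell-1})\in\mathbb{F}_{q^m}^\ell$ for $\ell\le m$. For a tuple $\mathbf n=(n_1,\dots,n_k)$ of integers in $\{1,\dots,m\}$, $\mathcal C_{\lambda,\mathbf n}$ is the code in $\mathbb{F}_{q^m}^{n_1+\dots+n_k}$ generated by the block-diagonal matrix whose $i$-th row is $\mathbf u_{\lambda,n_i}$ on the $i$-th block of $n_i$ consecutive coordinates (blocks of lengths $n_1,\dots,n_k$ in order) and $0$ elsewhere. *)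

theory Defs
  imports
    "Jordan_Normal_Form.VS_Connect"
    "HOL-Algebra.Embedded_Algebras"
    "HOL-Algebra.Generated_Fields"
    "HOL-Number_Theory.Prime_Powers"
begin

text \<open>
  The big field is a type \<open>'a\<close> of class \<open>field\<close>, viewed as a ring record through
  \<open>class_ring\<close>; the small field is a subset \<open>K\<close> with \<open>subfield K class_ring\<close>.
\<close>

definition rank_weight :: "'a::field set \<Rightarrow> 'a vec \<Rightarrow> nat" where
  "rank_weight K v = ring.dim class_ring K (ring.Span class_ring K (list_of_vec v))"

definition is_code :: "nat \<Rightarrow> nat \<Rightarrow> 'a::field vec set \<Rightarrow> bool" where
  "is_code n k C \<longleftrightarrow>
     VectorSpace.subspace class_ring C (module_vec TYPE('a) n) \<and>
     vectorspace.dim class_ring ((module_vec TYPE('a) n)\<lparr>carrier := C\<rparr>) = k"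

definition weight_spectrum :: "'a::field set \<Rightarrow> 'a vec set \<Rightarrow> nat set" where
  "weight_spectrum K C = rank_weight K ` {c \<in> C. c \<noteq> 0\<^sub>v (dim_vec c)}"

text \<open>On \<open>nat\<close>, \<open>div\<close> is the floor of the quotient. Intended for \<open>u \<ge> v \<ge> 2\<close>.\<close>

definition Psi :: "nat \<Rightarrow> nat \<Rightarrow> nat list" where
  "Psi u v = map (\<lambda>i. if i = 1 then nat \<lceil>real u / 2\<rceil>
                      else if i < v then nat \<lceil>real (u div 2 ^ (i - 1)) / 2\<rceil>
                      else u div 2 ^ (v - 1)) [1..<v + 1]"

definition power_vec :: "'a::field \<Rightarrow> nat \<Rightarrow> 'a vec" where
  "power_vec lam l = vec l (\<lambda>j. lam ^ j)"

definition block_code :: "'a::field \<Rightarrow> nat list \<Rightarrow> 'a vec set" where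
  "block_code lam ns = vec_space.row_space (sum_list ns)
     (diag_block_mat (map (\<lambda>l. mat_of_row (power_vec lam l)) ns))"

end

theory Submission
  imports Defs "HOL-Algebra.Finite_Extensions"
begin

text \<open>
  A codeword with coefficients \<open>\<alpha>\<^sub>1, \<dots>, \<alpha>\<^sub>k\<close> has weight \<open>dim (\<Sum>i. \<alpha>\<^sub>i V(n\<^sub>i))\<close>, where \<open>V(l)\<close> is the span of
  \<open>1, \<lambda>, \<dots>, \<lambda>\<^sup>l\<^sup>-\<^sup>1\<close>, of dimension \<open>l\<close> whenever \<open>l \<le> m\<close>. So every nonzero weight lies between the least
  block length and \<open>m\<close>. Conversely \<open>V(s) + \<lambda>\<^sup>w\<^sup>-\<^sup>x V(x) = V(w)\<close> if \<open>max s x \<le> w \<le> s + x\<close>; hence, reading the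
  block lengths from the right, all weights from the last length \<open>h\<close> up to \<open>m\<close> occur as soon as
  each length exceeds the sum of the later ones by at most one. Repeated halving yields such
  tuples.
\<close>

subsection \<open>Block lengths\<close>

text \<open>\<open>halves u v\<close> has \<open>v + 1\<close> entries: it is \<open>Psi u (v + 1)\<close>, extended to \<open>v = 0\<close>.\<close>

fun halves :: "nat \<Rightarrow> nat \<Rightarrow> nat list" where
  "halves u 0 = [u]"
| "halves u (Suc v) = (u - u div 2) # halves (u div 2) v"

lemma nat_ceiling_half: "nat \<lceil>real u / 2\<rceil> = u - u div 2"
proof -
  have "\<lceil>real u / 2\<rceil> = int (u - u div 2)"
    by (cases "even u") (auto elim!: evenE oddE simp: ceiling_eq_iff)
  then show ?thesis by simp
qed

text \<open>Successive floor divisions by 2 compose, so removing the first entry of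
  \<open>Psi\<close> leaves the same construction started at \<open>u div 2\<close>.\<close>

lemma Psi_step: "Psi u (Suc (Suc (Suc v))) = (u - u div 2) # Psi (u div 2) (Suc (Suc v))"
proof -
  let ?f = "\<lambda>i. if i = 1 then nat \<lceil>real u / 2\<rceil>
       else if i < Suc (Suc (Suc v)) then nat \<lceil>real (u div 2 ^ (i - 1)) / 2\<rceil>
       else u div 2 ^ (Suc (Suc (Suc v)) - 1)"
  have "[1..<Suc (Suc (Suc v)) + 1] = 1 # map Suc [1..<Suc (Suc v) + 1]"
    by (simp add: upt_conv_Cons map_Suc_upt del: upt_Suc)
  then have "Psi u (Suc (Suc (Suc v))) = ?f 1 # map (?f \<circ> Suc) [1..<Suc (Suc v) + 1]"
    unfolding Psi_def by (simp del: upt_Suc)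
  also have "map (?f \<circ> Suc) [1..<Suc (Suc v) + 1] = Psi (u div 2) (Suc (Suc v))"
    unfolding Psi_def
  proof (rule map_cong[OF refl])
    fix i assume "i \<in> set [1..<Suc (Suc v) + 1]"
    then obtain j where "i = Suc j" by (metis One_nat_def Suc_le_D atLeastLessThan_iff set_upt)
    then show "(?f \<circ> Suc) i = (if i = 1 then nat \<lceil>real (u div 2) / 2\<rceil>
       else if i < Suc (Suc v) then nat \<lceil>real (u div 2 div 2 ^ (i - 1)) / 2\<rceil>
       else u div 2 div 2 ^ (Suc (Suc v) - 1))"
      by (auto simp flip: div_mult2_eq)
  qed
  finally show ?thesis by (simp add: nat_ceiling_half)
qed

lemma Psi_eq_halves: "Psi u (Suc (Suc v)) = halves u (Suc v)"
proof (induction v arbitrary: u)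
  case 0
  have "[1..<Suc (Suc 0) + 1] = [1, 2]" by (simp add: upt_rec)
  then show ?case by (simp add: Psi_def nat_ceiling_half)
next
  case (Suc v)
  then show ?case by (simp add: Psi_step)
qed

lemma sum_list_halves: "sum_list (halves u v) = u"
  by (induction v arbitrary: u) auto

lemma length_halves: "length (halves u v) = Suc v"
  by (induction v arbitrary: u) auto

text \<open>The bound is the last entry. Each head is the larger half, hence at least
  \<open>u div 2\<close>, which later halvings only decrease.\<close>

lemma halves_ge: "x \<in> set (halves u v) \<Longrightarrow> u div 2 ^ v \<le> x"
proof (induction v arbitrary: u)
  case (Suc v)
  have "u div 2 ^ Suc v \<le> u div 2"
    using div_le_dividend[of "u div 2" "2 ^ v"] by (simp add: div_mult2_eq)
  also have "u div 2 \<le> u - u div 2" by linarith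
  finally show ?case using Suc.IH[of "u div 2"] Suc.prems by (auto simp: div_mult2_eq)
qed auto

text \<open>The first entry dominates, since the larger halves never increase along the list. At
  least one halving is required: with none, the only entry is \<open>u\<close> itself.\<close>

lemma halves_le: "x \<in> set (halves u (Suc v)) \<Longrightarrow> x \<le> u - u div 2"
proof (induction v arbitrary: u)
  case (Suc v)
  have "u div 2 - u div 2 div 2 \<le> u - u div 2" by linarith
  with Suc.IH[of "u div 2"] Suc.prems show ?case
    by (metis dual_order.trans halves.simps(2) order_refl set_ConsD)
qed auto

text \<open>The analogue of a complete sequence, with least representable value \<open>h\<close> instead of \<open>1\<close>.\<close>

fun complete_from :: "nat \<Rightarrow> nat list \<Rightarrow> bool" where
  "complete_from h [] \<longleftrightarrow> False"
| "complete_from h (x # xs) \<longleftrightarrow> x = h \<and> xs = [] \<or> complete_from h xs \<and> x \<le> Suc (sum_list xs)"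

text \<open>Each head is the ceiling of half of what is left, and the entries after it sum to the
  floor, so the excess is at most one; the last entry is \<open>u div 2 ^ v\<close>.\<close>

lemma complete_from_halves: "complete_from (u div 2 ^ v) (halves u v)"
  by (induction v arbitrary: u) (auto simp: div_mult2_eq sum_list_halves)

text \<open>Only the last entry of \<open>halves u v\<close> has to be compared with
  \<open>ys\<close>; for all earlier entries the extra summand makes the bound easier.\<close>

lemma complete_from_halves_append:
  assumes "complete_from h ys" and "u div 2 ^ v \<le> Suc (sum_list ys)"
  shows "complete_from h (halves u v @ ys)"
  using assms
proof (induction v arbitrary: u)
  case (Suc v)
  have "u - u div 2 \<le> Suc (u div 2 + sum_list ys)" by linarith
  with Suc show ?case by (simp add: div_mult2_eq sum_list_halves)
qed simp

text \<open>Prepended copies only enlarge the later sums, so the bound for the innermost copy serves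
  all of them.\<close>

lemma complete_from_replicate_append:
  assumes "complete_from h ys" and "x \<le> Suc (sum_list ys)"
  shows "complete_from h (replicate r x @ ys)"
  using assms by (induction r) (auto simp: sum_list_replicate)

lemma complete_from_ones: "0 < r \<Longrightarrow> complete_from 1 (replicate r 1)"
proof (induction r)
  case (Suc r)
  then show ?case by (cases r) auto
qed simp

subsection \<open>Codewords and dimension of block codes\<close>

text \<open>The codeword with row coefficients \<open>as\<close>, kept as a plain list so that
  inductions can peel off one block at a time.\<close>

definition block_word :: "'a::field \<Rightarrow> 'a list \<Rightarrow> nat list \<Rightarrow> 'a list" where
  "block_word lam as ns = concat (map2 (\<lambda>\<alpha> l. map (\<lambda>j. \<alpha> * lam ^ j) [0..<l]) as ns)"

lemma block_word_simps [simp]: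
  "block_word lam [] ns = []"
  "block_word lam as [] = []"
  "block_word lam (\<alpha> # as) (l # ns) = map (\<lambda>j. \<alpha> * lam ^ j) [0..<l] @ block_word lam as ns"
  by (simp_all add: block_word_def)

lemma length_block_word: "length as = length ns \<Longrightarrow> length (block_word lam as ns) = sum_list ns"
  by (induction as ns rule: list_induct2) auto

lemma in_set_block_word:
  "length as = length ns \<Longrightarrow> x \<in> set (block_word lam as ns) \<longleftrightarrow>
    (\<exists>i<length ns. \<exists>j<ns ! i. x = as ! i * lam ^ j)"
proof (induction as ns rule: list_induct2)
  case (Cons \<alpha> as l ns)
  then show ?case by (auto simp: Ex_less_Suc2)
qed simp

lemma block_word_inj:
  assumes "length as = length ns" "length bs = length ns" "\<forall>l\<in>set ns. 0 < l"
    and "block_word lam as ns = block_word lam bs ns"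
  shows "as = bs"
  using assms
proof (induction ns arbitrary: as bs)
  case (Cons l ns)
  then obtain \<alpha> as' \<beta> bs' where [simp]: "as = \<alpha> # as'" "bs = \<beta> # bs'"
    by (metis length_Suc_conv)
  \<comment> \<open>The first coordinate of a nonempty block is the coefficient itself, because
    \<open>lam ^ 0 = 1\<close>.\<close>
  have "0 \<in> {0..<l}" using Cons.prems(3) by simp
  then have "\<alpha> = \<beta>" using Cons.prems(4) by fastforce
  then show ?case using Cons by simp
qed simp

definition block_gen :: "'a::field \<Rightarrow> nat list \<Rightarrow> 'a mat" where
  "block_gen lam ns = diag_block_mat (map (\<lambda>l. mat_of_row (power_vec lam l)) ns)"

lemma block_gen_carrier: "block_gen lam ns \<in> carrier_mat (length ns) (sum_list ns)"
  unfolding block_gen_def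
  by (intro carrier_matI) (auto simp: dim_diag_block_mat o_def power_vec_def sum_list_triv)

text \<open>The row space is the image of the transposed generator matrix, so this is the bridge
  between coefficient lists and codewords. The block form of the transpose splits off the first
  block.\<close>

lemma transpose_block_gen_mult:
  "length as = length ns \<Longrightarrow>
    (block_gen lam ns)\<^sup>T *\<^sub>v vec_of_list as = vec_of_list (block_word lam as ns)"
proof (induction as ns rule: list_induct2)
  case Nil
  show ?case by (intro eq_vecI) (auto simp: block_gen_def)
next
  case (Cons \<alpha> as l ns)
  let ?u = "mat_of_row (power_vec lam l)"
  let ?B = "block_gen lam ns"
  have u: "?u \<in> carrier_mat 1 l" by (simp add: power_vec_def carrier_matI)
  have B: "?B \<in> carrier_mat (length ns) (sum_list ns)" by (rule block_gen_carrier)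
  have G: "block_gen lam (l # ns) = four_block_mat ?u (0\<^sub>m 1 (sum_list ns)) (0\<^sub>m (length ns) l) ?B"
    using u B by (simp add: block_gen_def Let_def power_vec_def)
  have GT: "(block_gen lam (l # ns))\<^sup>T =
      four_block_mat ?u\<^sup>T (0\<^sub>m l (length ns)) (0\<^sub>m (sum_list ns) 1) ?B\<^sup>T"
    unfolding G using u B by (subst transpose_four_block_mat) auto
  have split: "vec_of_list (xs @ ys) = vec_of_list xs @\<^sub>v vec_of_list ys" for xs ys :: "'a list"
    by (intro eq_vecI) (auto simp: vec_of_list_index nth_append)
  have "vec_of_list (\<alpha> # as) = vec_of_list [\<alpha>] @\<^sub>v vec_of_list as"
    using split[of "[\<alpha>]" as] by simp
  moreover have "four_block_mat ?u\<^sup>T (0\<^sub>m l (length ns)) (0\<^sub>m (sum_list ns) 1) ?B\<^sup>T *\<^sub>v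
      (vec_of_list [\<alpha>] @\<^sub>v vec_of_list as) =
      (?u\<^sup>T *\<^sub>v vec_of_list [\<alpha>] + 0\<^sub>m l (length ns) *\<^sub>v vec_of_list as) @\<^sub>v
      (0\<^sub>m (sum_list ns) 1 *\<^sub>v vec_of_list [\<alpha>] + ?B\<^sup>T *\<^sub>v vec_of_list as)"
    using u B Cons.hyps by (intro four_block_mat_mult_vec) (auto intro!: carrier_vecI)
  moreover have "?u\<^sup>T *\<^sub>v vec_of_list [\<alpha>] + 0\<^sub>m l (length ns) *\<^sub>v vec_of_list as =
      vec_of_list (map (\<lambda>j. \<alpha> * lam ^ j) [0..<l])"
    using u Cons.hyps
    by (intro eq_vecI) (auto simp: vec_of_list_index scalar_prod_def power_vec_def mat_of_row_def)
  moreover have "0\<^sub>m (sum_list ns) 1 *\<^sub>v vec_of_list [\<alpha>] + ?B\<^sup>T *\<^sub>v vec_of_list as =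
      vec_of_list (block_word lam as ns)"
    unfolding Cons.IH using Cons.hyps
    by (intro eq_vecI) (auto simp: vec_of_list_index scalar_prod_def length_block_word)
  ultimately show ?case by (simp add: GT split)
qed

lemma block_code_eq:
  "block_code lam ns = {vec_of_list (block_word lam as ns) | as. length as = length ns}"
proof -
  have "block_code lam ns = {w \<in> carrier_vec (sum_list ns).
      \<exists>y\<in>carrier_vec (length ns). (block_gen lam ns)\<^sup>T *\<^sub>v y = w}"
    using vec_space.row_space_eq[OF block_gen_carrier[of lam ns]] block_gen_carrier[of lam ns]
    unfolding block_code_def block_gen_def by simp
  also have "\<dots> = {vec_of_list (block_word lam as ns) | as. length as = length ns}"
  proof (intro equalityI subsetI)
    fix w assume "w \<in> {w \<in> carrier_vec (sum_list ns).
      \<exists>y\<in>carrier_vec (length ns). (block_gen lam ns)\<^sup>T *\<^sub>v y = w}"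
    then obtain y where y: "y \<in> carrier_vec (length ns)" "(block_gen lam ns)\<^sup>T *\<^sub>v y = w" by auto
    then have "w = vec_of_list (block_word lam (list_of_vec y) ns)"
      using transpose_block_gen_mult[of "list_of_vec y" ns lam] by (simp add: vec_list)
    then show "w \<in> {vec_of_list (block_word lam as ns) | as. length as = length ns}"
      using y by (intro CollectI exI[of _ "list_of_vec y"]) auto
  next
    fix w assume "w \<in> {vec_of_list (block_word lam as ns) | as. length as = length ns}"
    then obtain as where as: "length as = length ns" "w = vec_of_list (block_word lam as ns)" by auto
    then show "w \<in> {w \<in> carrier_vec (sum_list ns).
      \<exists>y\<in>carrier_vec (length ns). (block_gen lam ns)\<^sup>T *\<^sub>v y = w}"
      using transpose_block_gen_mult[of as ns lam]
      by (auto simp: length_block_word intro!: carrier_vecI bexI[of _ "vec_of_list as"])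
  qed
  finally show ?thesis .
qed

text \<open>Encoding is a linear bijection from coefficient vectors onto the code, so the dimension
  is the number of blocks. Nonempty blocks make it injective.\<close>

lemma is_code_block_code:
  fixes lam :: "'a::field"
  assumes pos: "\<forall>l\<in>set ns. 0 < l"
  shows "is_code (sum_list ns) (length ns) (block_code lam ns)"
proof -
  let ?n = "sum_list ns" and ?k = "length ns"
  let ?A = "block_gen lam ns"
  let ?T = "\<lambda>y. ?A\<^sup>T *\<^sub>v y"
  interpret V: vec_space "TYPE('a)" ?k .
  interpret W: vec_space "TYPE('a)" ?n .
  have A: "?A \<in> carrier_mat ?k ?n" by (rule block_gen_carrier)
  have C: "block_code lam ns = W.row_space ?A" by (simp add: block_code_def block_gen_def)
  have sub: "VectorSpace.subspace class_ring (block_code lam ns) W.V"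
    unfolding C W.row_space_def using A rows_carrier[of ?A]
    by (intro W.span_is_subspace) auto
  have vs: "vectorspace class_ring (W.vs (block_code lam ns))"
    unfolding C by (rule W.vector_space_row_space[OF A])
  have img: "?T ` carrier_vec ?k = block_code lam ns"
    unfolding C W.row_space_eq[OF A] using A by auto
  have lin: "linear_map class_ring V.V (W.vs (block_code lam ns)) ?T"
  proof (intro linear_map.intro mod_hom.intro mod_hom_axioms.intro)
    show "?T \<in> LinearCombinations.module_hom class_ring V.V (W.vs (block_code lam ns))"
      using A img by (auto simp: LinearCombinations.module_hom_def module_vec_def mult_add_distrib_mat_vec)
  qed (use vs in \<open>auto simp: vectorspace_def V.vectorspace_axioms V.module_axioms\<close>)
  interpret L: linear_map class_ring V.V "W.vs (block_code lam ns)" ?T by (rule lin)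
  have inj: "inj_on ?T (carrier V.V)"
  proof (rule inj_onI)
    fix x y assume x: "x \<in> carrier V.V" and y: "y \<in> carrier V.V" and eq: "?T x = ?T y"
    have "vec_of_list (block_word lam (list_of_vec x) ns) = vec_of_list (block_word lam (list_of_vec y) ns)"
      using x y eq transpose_block_gen_mult[of "list_of_vec x" ns lam]
        transpose_block_gen_mult[of "list_of_vec y" ns lam] by (simp add: vec_list)
    then have "block_word lam (list_of_vec x) ns = block_word lam (list_of_vec y) ns"
      by (metis list_vec)
    then have "list_of_vec x = list_of_vec y"
      using x y pos block_word_inj[of "list_of_vec x" ns "list_of_vec y" lam] by simp
    then show "x = y" by (metis vec_list)
  qed
  have "V.dim = vectorspace.dim class_ring (W.vs (block_code lam ns))"
    using img by (intro L.dim_eq[OF V.fin_dim inj]) simp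
  then show ?thesis
    unfolding is_code_def using sub V.dim_is_n by simp
qed

subsection \<open>Rank weights of codewords\<close>

abbreviation lspan :: "'a::field set \<Rightarrow> 'a list \<Rightarrow> 'a set" where
  "lspan \<equiv> ring.Span class_ring"

abbreviation lindpt :: "'a::field set \<Rightarrow> 'a list \<Rightarrow> bool" where
  "lindpt \<equiv> ring.independent class_ring"

lemma class_domain: "domain (class_ring :: 'a::field ring)"
  by (rule field.axioms(1)[OF class_field])

lemmas class_ring_ring = class_ring.ring_axioms

definition powers :: "'a::field \<Rightarrow> nat \<Rightarrow> 'a list" where
  "powers lam l = map (\<lambda>j. lam ^ j) [0..<l]"

section \<open>Spans, independence and dimension over the subfield \<open>K\<close>\<close>

context
  fixes K :: "'a::field set"
  assumes K: "subfield K class_ring"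
begin

lemma lspan_base: "set us \<subseteq> lspan K us"
  by (rule ring.Span_base_incl[OF class_ring_ring K]) simp

lemma lspan_mono: "set us \<subseteq> lspan K vs \<Longrightarrow> lspan K us \<subseteq> lspan K vs"
  by (rule ring.mono_Span_subset[OF class_ring_ring K]) simp_all

lemma lspan_Nil: "lspan K [] = {0}"
  by (simp add: ring.Span.simps[OF class_ring_ring])

lemma lspan_mult:
  assumes "x \<in> lspan K us"
  shows "c * x \<in> lspan K (map ((*) c) us)"
  using assms
proof (induction us arbitrary: x)
  case Nil
  then show ?case by (simp add: lspan_Nil)
next
  case (Cons u us)
  then show ?case
    by (auto simp: ring.Span.simps[OF class_ring_ring]
      ring.line_extension_mem_iff[OF class_ring_ring]) (metis distrib_left mult.left_commute)
qed

text \<open>Multiplication by \<open>inverse c\<close> carries a dependence among the scaled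
  elements back to one among the original elements.\<close>

lemma lindpt_map_mult:
  assumes "lindpt K us" "c \<noteq> 0"
  shows "lindpt K (map ((*) c) us)"
  using assms(1)
proof (induction us)
  case Nil
  then show ?case by (simp add: ring.li_Nil[OF class_ring_ring])
next
  case (Cons u us)
  from ring.independent_backwards[OF class_ring_ring Cons.prems]
  have "u \<notin> lspan K us" "lindpt K us" by auto
  moreover from this(1) have "c * u \<notin> lspan K (map ((*) c) us)"
    using lspan_mult[of "c * u" "map ((*) c) us" "inverse c"] \<open>c \<noteq> 0\<close>
    by (auto simp: o_def mult.assoc[symmetric])
  ultimately show ?case using Cons.IH
    by (auto intro: ring.li_Cons[OF class_ring_ring])
qed

lemma dim_eqI: "ring.dimension class_ring n K E \<Longrightarrow> ring.dim class_ring K E = n"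
  using ring.dimI[OF class_ring_ring K] by (simp add: over_def)

lemma dim_lspan: "lindpt K us \<Longrightarrow> ring.dim class_ring K (lspan K us) = length us"
  by (intro dim_eqI ring.dimension_independent[OF class_ring_ring])

text \<open>Thinning \<open>vs\<close> to a base turns \<open>ring.dim\<close> into a list length,
  and no independent family in its span is longer.\<close>

lemma lindpt_length_le_dim:
  assumes "lindpt K us" "set us \<subseteq> lspan K vs"
  shows "length us \<le> ring.dim class_ring K (lspan K vs)"
proof -
  obtain bs where bs: "lindpt K bs" "lspan K bs = lspan K vs"
    using ring.filter_base[OF class_ring_ring K, of vs] by auto
  have "length us \<le> length bs"
    using assms bs by (intro ring.independent_length_le[OF class_ring_ring K]) auto
  then show ?thesis using dim_lspan[OF bs(1)] bs(2) by simp
qed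

lemma dim_lspan_le:
  assumes "ring.dimension class_ring m K (UNIV :: 'a set)"
  shows "ring.dim class_ring K (lspan K vs) \<le> m"
proof -
  obtain bs where bs: "lindpt K bs" "lspan K bs = lspan K vs"
    using ring.filter_base[OF class_ring_ring K, of vs] by auto
  have "length bs \<le> m"
    using ring.independent_length_le_dimension[OF class_ring_ring K assms bs(1)] by simp
  then show ?thesis using dim_lspan[OF bs(1)] bs(2) by simp
qed

text \<open>As the big field has finite dimension, \<open>lam\<close> is algebraic over
  \<open>K\<close>. Its simple extension is everything, so its minimal polynomial has degree
  \<open>m\<close>, and the powers below the degree are independent.\<close>

lemma lindpt_powers:
  assumes dim: "ring.dimension class_ring m K (UNIV :: 'a set)"
    and gen: "generate_field class_ring (K \<union> {lam}) = UNIV" and "l \<le> m"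
  shows "lindpt K (powers lam l)"
proof -
  let ?R = "class_ring :: 'a ring"
  have pow: "x [^]\<^bsub>?R\<^esub> (i::nat) = x ^ i" for x i by (simp add: class_ring_simps)
  have fd: "ring.finite_dimension ?R K UNIV"
    using dim ring.finite_dimension_def[OF class_ring_ring] by (auto simp: over_def)
  have "subring (UNIV :: 'a set) ?R"
    using ring.carrier_is_subring[OF class_ring_ring] by (simp add: class_ring_simps)
  then have alg: "(ring.algebraic ?R over K) lam"
    using ring.finite_dimension_imp_algebraic[OF class_ring_ring K _ fd] by simp
  \<comment> \<open>Polynomials are coefficient lists, so the degree is the length minus
    one.\<close>
  let ?d = "length (ring.Irr ?R K lam) - 1"
  have subf: "subfield (ring.simple_extension ?R K lam) ?R"
    using domain.simple_extension_is_subfield[OF class_domain K] alg by (simp add: class_ring_simps)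
  have subr: "subring K ?R" using K by (rule subfieldE)
  have "K \<union> {lam} \<subseteq> ring.simple_extension ?R K lam"
    using ring.simple_extension_incl[OF class_ring_ring, of K lam]
      ring.simple_extension_mem[OF class_ring_ring subr, of lam] by (simp add: class_ring_simps)
  then have "generate_field ?R (K \<union> {lam}) \<subseteq> ring.simple_extension ?R K lam"
    using field.generate_field_min_subfield1[OF class_field _ subf] by (simp add: class_ring_simps)
  then have simple: "ring.simple_extension ?R K lam = UNIV" using gen by blast
  have "ring.dimension ?R ?d K UNIV"
    using domain.dimension_simple_extension[OF class_domain K _ alg] simple by (simp add: class_ring_simps)
  then have "?d = m" using ring.dimension_is_inj[OF class_ring_ring K] dim by blast
  moreover have "lindpt K (ring.exp_base ?R lam ?d)"
    using domain.exp_base_independent[OF class_domain K _ alg] by (simp add: class_ring_simps)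
  ultimately have "lindpt K (map (\<lambda>i. lam ^ i) (rev [0..<m]))"
    by (simp add: ring.exp_base_def[OF class_ring_ring] pow)
  \<comment> \<open>\<open>exp_base\<close> lists the powers in descending order, so the lowest
    \<open>l\<close> powers form a final segment.\<close>
  moreover have "[0..<m] = [0..<l] @ [l..<m]" using \<open>l \<le> m\<close> upt_add_eq_append[of 0 l "m - l"] by simp
  ultimately have "lindpt K (map (\<lambda>i. lam ^ i) (rev [l..<m]) @ map (\<lambda>i. lam ^ i) (rev [0..<l]))"
    by simp
  then have "lindpt K (map (\<lambda>i. lam ^ i) (rev [0..<l]))"
    by (rule ring.independent_split(1)[OF class_ring_ring K])
  then show ?thesis
    unfolding powers_def by (rule ring.independent_same_set[OF class_ring_ring K, rotated 2]) auto
qed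

section \<open>Bounds for the weights and their attainment\<close>

lemma dim_block_word_ge:
  assumes dim: "ring.dimension class_ring m K (UNIV :: 'a set)"
    and gen: "generate_field class_ring (K \<union> {lam}) = UNIV"
    and "length as = length ns" "i < length ns" "as ! i \<noteq> 0" "ns ! i \<le> m"
  shows "ns ! i \<le> ring.dim class_ring K (lspan K (block_word lam as ns))"
proof -
  \<comment> \<open>A single block with nonzero coefficient already contributes as many independent
    entries as its length.\<close>
  have "lindpt K (map ((*) (as ! i)) (powers lam (ns ! i)))"
    using assms by (intro lindpt_map_mult lindpt_powers[OF dim gen])
  moreover have "set (map ((*) (as ! i)) (powers lam (ns ! i))) \<subseteq> set (block_word lam as ns)"
    using assms(3,4) by (fastforce simp: powers_def in_set_block_word)
  ultimately show ?thesis
    using lindpt_length_le_dim[of "map ((*) (as ! i)) (powers lam (ns ! i))" "block_word lam as ns"]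
      lspan_base[of "block_word lam as ns"]
    by (auto simp: powers_def)
qed

text \<open>Greedy choice from the left: if the later blocks can reach \<open>w\<close>, the head
  gets coefficient 0; otherwise they produce all exponents below their total length, and the head is
  shifted to cover the top ones.\<close>

lemma exists_block_word_lspan:
  assumes "complete_from h ns" "h \<le> w" "w \<le> sum_list ns" "w \<le> m" "\<forall>l\<in>set ns. l \<le> m"
  shows "\<exists>as. length as = length ns \<and> lspan K (block_word lam as ns) = lspan K (powers lam w)"
  using assms
proof (induction ns arbitrary: w)
  case (Cons x xs)
  show ?case
  proof (cases "xs = []")
    case True
    \<comment> \<open>A single block has \<open>x = h\<close>, so \<open>h\<close> is the only
      admissible value of \<open>w\<close>.\<close>
    then have "w = x" using Cons.prems by auto
    then show ?thesis using True
      by (intro exI[of _ "[1]"]) (simp add: powers_def)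
  next
    case False
    then have c: "complete_from h xs" "x \<le> Suc (sum_list xs)" using Cons.prems by auto
    show ?thesis
    proof (cases "w \<le> sum_list xs")
      case True
      then obtain as where as: "length as = length xs"
        "lspan K (block_word lam as xs) = lspan K (powers lam w)"
        using Cons.IH[OF c(1), of w] Cons.prems by auto
      have "0 \<in> lspan K (block_word lam as xs)"
        using ring.Span_subgroup_props(2)[OF class_ring_ring K] by simp
      then have "set (block_word lam (0 # as) (x # xs)) \<subseteq> lspan K (block_word lam as xs)"
        using lspan_base[of "block_word lam as xs"] by auto
      moreover have "set (block_word lam as xs) \<subseteq> lspan K (block_word lam (0 # as) (x # xs))"
        using lspan_base[of "block_word lam (0 # as) (x # xs)"] by auto
      ultimately have "lspan K (block_word lam (0 # as) (x # xs)) = lspan K (block_word lam as xs)"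
        using lspan_mono by blast
      then show ?thesis using as by (intro exI[of _ "0 # as"]) simp
    next
      case gt: False
      let ?s = "sum_list xs"
      \<comment> \<open>The last entry of \<open>xs\<close> is \<open>h\<close>; the induction
        hypothesis therefore applies with target \<open>?s\<close>.\<close>
      have "h \<le> ?s"
        using c(1) by (induction xs) auto
      then obtain as where as: "length as = length xs"
        "lspan K (block_word lam as xs) = lspan K (powers lam ?s)"
        using Cons.IH[OF c(1), of ?s] Cons.prems gt by auto
      \<comment> \<open>The factor \<open>lam ^ (w - x)\<close> moves the exponents of the head
        block to the top \<open>x\<close> ones below \<open>w\<close>.\<close>
      let ?B = "block_word lam (lam ^ (w - x) # as) (x # xs)"
      \<comment> \<open>Completeness gives \<open>x \<le> ?s + 1 \<le> w\<close>, so the shift is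
        not truncated; \<open>w \<le> x + ?s\<close> leaves no gap between the two ranges of
        exponents.\<close>
      have wx: "x \<le> w" "w - x \<le> ?s" using gt c(2) Cons.prems by auto
      have set_pow: "set (powers lam l) = (\<lambda>j. lam ^ j) ` {..<l}" for l
        by (auto simp: powers_def)
      have setB: "set ?B = (\<lambda>j. lam ^ j) ` {w - x..<w} \<union> set (block_word lam as xs)"
      proof -
        have "(\<lambda>j. lam ^ (w - x) * lam ^ j) ` {0..<x} = (\<lambda>j. lam ^ j) ` ((+) (w - x)) ` {0..<x}"
          by (simp only: image_image power_add)
        also have "(+) (w - x) ` {0..<x} = {w - x..<w}"
          using wx image_add_atLeastLessThan[of "w - x" 0 x] by (simp del: image_add_atLeastLessThan)
        finally show ?thesis by simp
      qed
      have "set (block_word lam as xs) \<subseteq> lspan K (powers lam ?s)"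
        using as(2) lspan_base by metis
      also have "lspan K (powers lam ?s) \<subseteq> lspan K (powers lam w)"
        using lspan_base[of "powers lam w"] gt by (intro lspan_mono) (auto simp: set_pow)
      finally have "set ?B \<subseteq> lspan K (powers lam w)"
        using lspan_base[of "powers lam w"] unfolding setB by (auto simp: set_pow)
      moreover have "set (powers lam w) \<subseteq> lspan K ?B"
      proof -
        have "lspan K (powers lam ?s) \<subseteq> lspan K ?B"
          unfolding as(2)[symmetric] using lspan_base[of ?B] setB by (intro lspan_mono) auto
        then have "lam ^ j \<in> lspan K ?B" if "j < ?s" for j
          using lspan_base[of "powers lam ?s"] that by (auto simp: set_pow)
        moreover have "lam ^ j \<in> lspan K ?B" if "w - x \<le> j" "j < w" for j
        proof -
          have "lam ^ j \<in> set ?B" unfolding setB using that by simp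
          then show ?thesis using lspan_base[of ?B] by blast
        qed
        ultimately show ?thesis using wx unfolding set_pow
          by (auto simp: not_less) (meson le_trans not_less)
      qed
      ultimately have "lspan K ?B = lspan K (powers lam w)" using lspan_mono by blast
      then show ?thesis using as(1) by (intro exI[of _ "lam ^ (w - x) # as"]) simp
    qed
  qed
qed simp

text \<open>Any nonzero coefficient forces weight at least the length of its block, hence at least
  \<open>h\<close>, and the ambient dimension caps it at \<open>m\<close>. As
  \<open>m \<le> sum_list ns\<close>, completeness realizes every value in between.\<close>

lemma weight_spectrum_block_code:
  assumes dim: "ring.dimension class_ring m K (UNIV :: 'a set)"
    and gen: "generate_field class_ring (K \<union> {lam}) = UNIV"
    and comp: "complete_from h ns" and "0 < h" and ns: "\<forall>l\<in>set ns. h \<le> l \<and> l \<le> m"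
    and "m \<le> sum_list ns"
  shows "weight_spectrum K (block_code lam ns) = {h..m}"
proof (intro equalityI subsetI)
  fix w assume "w \<in> weight_spectrum K (block_code lam ns)"
  then obtain as where as: "length as = length ns"
    "vec_of_list (block_word lam as ns) \<noteq> 0\<^sub>v (dim_vec (vec_of_list (block_word lam as ns)))"
    "w = ring.dim class_ring K (lspan K (block_word lam as ns))"
    unfolding weight_spectrum_def block_code_eq rank_weight_def by (auto simp: list_vec)
  have "\<exists>i<length ns. as ! i \<noteq> 0"
  proof (rule ccontr)
    assume "\<not> ?thesis"
    then have "\<forall>x\<in>set (block_word lam as ns). x = 0" using as(1) by (auto simp: in_set_block_word)
    then show False using as(2)
      by (auto simp: vec_eq_iff vec_of_list_index)
  qed
  then obtain i where "i < length ns" "as ! i \<noteq> 0" by auto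
  then have "ns ! i \<le> w" "h \<le> ns ! i"
    using dim_block_word_ge[OF dim gen as(1)] as(3) ns by auto
  then show "w \<in> {h..m}" using dim_lspan_le[OF dim] as(3) by auto
next
  fix w assume w: "w \<in> {h..m}"
  then obtain as where as: "length as = length ns"
    "lspan K (block_word lam as ns) = lspan K (powers lam w)"
    using exists_block_word_lspan[OF comp, of w m lam] ns \<open>m \<le> sum_list ns\<close> by auto
  have li: "lindpt K (powers lam w)" using w by (intro lindpt_powers[OF dim gen]) auto
  have wt: "rank_weight K (vec_of_list (block_word lam as ns)) = w"
    unfolding rank_weight_def using as(2) dim_lspan[OF li] by (simp add: list_vec powers_def)
  have "vec_of_list (block_word lam as ns) \<noteq> 0\<^sub>v (dim_vec (vec_of_list (block_word lam as ns)))"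
  proof
    assume z: "vec_of_list (block_word lam as ns) = 0\<^sub>v (dim_vec (vec_of_list (block_word lam as ns)))"
    have "set (block_word lam as ns) \<subseteq> {0}"
      using z by (auto simp: vec_eq_iff vec_of_list_index in_set_conv_nth)
    then have "lspan K (block_word lam as ns) \<subseteq> {0}"
      using lspan_mono[of _ "[]"] unfolding lspan_Nil by simp
    \<comment> \<open>The word is nonzero because its span contains \<open>lam ^ 0\<close>, as
      \<open>0 < h \<le> w\<close>.\<close>
    moreover have "1 \<in> lspan K (powers lam w)"
    proof -
      have "0 < w" using w \<open>0 < h\<close> by auto
      then have "1 \<in> set (powers lam w)" by (auto simp: powers_def intro!: image_eqI[of _ _ 0])
      then show ?thesis using lspan_base by blast
    qed
    ultimately show False using as(2) by auto
  qed
  then show "w \<in> weight_spectrum K (block_code lam ns)"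
    unfolding weight_spectrum_def block_code_eq using as(1) wt by (auto intro!: image_eqI)
qed

end

section \<open>Completeness of the prescribed block lengths\<close>

theorem theorem4p8:
  fixes K :: "'a::field set" and lam :: 'a
    and q n m k t a h z \<beta> \<gamma> :: nat and H :: "nat set" and ns :: "nat list"
  assumes "primepow q"
    and "subfield K class_ring" and "card K = q"
    and "ring.dimension class_ring m K (UNIV :: 'a set)"
    and "1 < k" and "k < n" and "m < n" and "n \<le> k * m"
    and "generate_field class_ring (K \<union> {lam}) = UNIV"
    and "t = (k * m - n) div m"
    and "a = n - (k - t - 2) * m"
    and "h = max (a div 2 ^ (t + 1)) 1"
    and "H = {i. (real a - real i) / 2 powi (int t + 1 - int i) \<ge> 1}"
    and "z = (LEAST i. i \<in> H)"
    and "\<beta> = (n - k) div (m - 1)"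
    and "\<gamma> = (n - k) - (m - 1) * \<beta>"
    and "ns =
      (if a \<ge> t + 2 then
         if z = 0 then replicate (k - t - 2) m @ Psi a (t + 2)
         else replicate (k - t - 2) m @ Psi (a - z) (t - z + 2) @ replicate z 1
       else replicate \<beta> m @ [\<gamma> + 1] @ replicate (k - \<beta> - 1) 1)"
  shows "is_code n k (block_code lam ns) \<and>
         weight_spectrum K (block_code lam ns) = {h..m} \<and>
         card (weight_spectrum K (block_code lam ns)) = m - h + 1"
proof -
  have "2 \<le> m"
  proof (rule ccontr)
    assume "\<not> 2 \<le> m"
    then have "k * m \<le> k * 1" by (intro mult_le_mono2) simp
    then show False using assms(6,8) by linarith
  qed
  define r where "r = (k * m - n) mod m"
  have r: "k * m - n = t * m + r" "r < m"
    unfolding r_def assms(10) using \<open>2 \<le> m\<close> by auto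
  then have kmn: "k * m = n + t * m + r" using assms(8) by simp
  \<comment> \<open>This keeps the natural subtraction \<open>k - t - 2\<close> from being
    truncated.\<close>
  have "t + 1 < k"
  proof (rule ccontr)
    assume "\<not> t + 1 < k"
    then have "k * m \<le> (t + 1) * m" by (intro mult_le_mono1) simp
    then show False using kmn assms(7) by simp
  qed
  define d where "d = k - t - 2"
  have k: "k = d + t + 2" unfolding d_def using \<open>t + 1 < k\<close> by simp
  \<comment> \<open>Thus \<open>a\<close> is what the last \<open>t + 2\<close> blocks share, and it
    lies in the range from \<open>m + 1\<close> to \<open>2 * m\<close>.\<close>
  have "a + r = 2 * m" and n: "n = d * m + a"
    using kmn r(2) unfolding assms(11) d_def[symmetric] k by (auto simp: algebra_simps)
  then have a: "m < a" "a \<le> 2 * m" using r(2) by auto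
  \<comment> \<open>Membership of \<open>i\<close> says that after setting aside \<open>i\<close>
    ones, halving the rest \<open>t + 1 - i\<close> times leaves a last part of at least 1.\<close>
  have H_iff: "i \<in> H \<longleftrightarrow> i + 2 ^ (t + 1 - i) \<le> a" if "i \<le> t + 1" for i
  proof -
    have "int t + 1 - int i = int (t + 1 - i)" using that by simp
    then have "(2::real) powi (int t + 1 - int i) = 2 ^ (t + 1 - i)"
      by (simp only: power_int_of_nat)
    then have "i \<in> H \<longleftrightarrow> 2 ^ (t + 1 - i) \<le> real a - real i"
      unfolding assms(13) mem_Collect_eq by (simp only: le_divide_eq) simp
    also have "\<dots> \<longleftrightarrow> real (i + 2 ^ (t + 1 - i)) \<le> real a" by auto
    finally show ?thesis by (simp only: of_nat_le_iff)
  qed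
  have key: "sum_list ns = n \<and> length ns = k \<and> complete_from h ns \<and> (\<forall>l\<in>set ns. h \<le> l \<and> l \<le> m)"
  proof (cases "t + 2 \<le> a")
    case True
    \<comment> \<open>This makes the least element exist and bounds it by \<open>t\<close>, so at
      least one halving remains.\<close>
    have "t \<in> H" using H_iff[of t] True by simp
    then have "z \<le> t" unfolding assms(14) by (rule Least_le)
    have "z \<in> H" unfolding assms(14) using \<open>t \<in> H\<close> by (rule LeastI)
    show ?thesis
    proof (cases "z = 0")
      case z: True
      then have "2 ^ (t + 1) \<le> a" using H_iff[of 0] \<open>z \<in> H\<close> by simp
      then have "0 < a div 2 ^ (t + 1)" by (simp add: div_greater_zero_iff)
      then have h: "h = a div 2 ^ (t + 1)" unfolding assms(12) by linarith
      have ns: "ns = replicate d m @ halves a (t + 1)"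
        using True z Psi_eq_halves[of a t] by (simp add: assms(17) d_def)
      have le: "l \<le> m" if "l \<in> set (halves a (t + 1))" for l
        using halves_le[of l a t] that a by simp
      \<comment> \<open>The first entry lies between both bounds; the inequality is needed for the
        leading entries \<open>m\<close>.\<close>
      have "h \<le> m"
        using le[of "a - a div 2"] halves_ge[of "a - a div 2" a "t + 1"] unfolding h by simp
      then show ?thesis
        unfolding ns using le halves_ge[of _ a "t + 1"] complete_from_halves[of a "t + 1"] a n k
        by (auto simp: sum_list_halves length_halves sum_list_replicate h
          simp del: halves.simps intro!: complete_from_replicate_append)
    next
      case z: False
      have "\<not> 2 ^ (t + 1) \<le> a" using not_less_Least[of 0 "\<lambda>i. i \<in> H"] z H_iff[of 0]
        unfolding assms(14) by simp
      then have h: "h = 1" unfolding assms(12) by simp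
      have za: "z + 2 ^ (t + 1 - z) \<le> a" using H_iff[of z] \<open>z \<in> H\<close> \<open>z \<le> t\<close> by simp
      \<comment> \<open>Minimality of \<open>z\<close> bounds the last halved entry above by 1, and
        \<open>z \<in> H\<close> bounds it below by 1, so it joins the trailing ones without a
        jump.\<close>
      have "z - 1 \<notin> H" using not_less_Least[of "z - 1" "\<lambda>i. i \<in> H"] z
        unfolding assms(14) by simp
      moreover have "t + 1 - (z - 1) = Suc (t + 1 - z)" using z \<open>z \<le> t\<close> by simp
      ultimately have "\<not> z - 1 + 2 * 2 ^ (t + 1 - z) \<le> a"
        using H_iff[of "z - 1"] \<open>z \<le> t\<close> by simp
      then have "a - z < 2 * 2 ^ (t + 1 - z)" using z za by linarith
      then have last_le: "(a - z) div 2 ^ (t + 1 - z) \<le> 1"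
        by (simp add: less_mult_imp_div_less flip: less_Suc_eq_le)
      have last_ge: "1 \<le> (a - z) div 2 ^ (t + 1 - z)"
        using za by (simp add: Suc_le_eq div_greater_zero_iff)
      have tz: "t + 1 - z = Suc (t - z)" using \<open>z \<le> t\<close> by simp
      have ns: "ns = replicate d m @ halves (a - z) (t + 1 - z) @ replicate z 1"
        using True z Psi_eq_halves[of "a - z" "t - z"] unfolding tz by (simp add: assms(17) d_def)
      have le: "l \<le> m" if "l \<in> set (halves (a - z) (t + 1 - z))" for l
        using halves_le[of l "a - z" "t - z"] that a unfolding tz by simp
      have ge: "1 \<le> l" if "l \<in> set (halves (a - z) (t + 1 - z))" for l
        using halves_ge[OF that] last_ge by simp
      have "complete_from 1 (halves (a - z) (t + 1 - z) @ replicate z 1)"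
        using last_le z by (intro complete_from_halves_append complete_from_ones) auto
      \<comment> \<open>The entries after the leading ones sum to \<open>a > m\<close>, so copies of
        \<open>m\<close> may be prepended.\<close>
      then have "complete_from 1 ns"
        unfolding ns using a za
        by (intro complete_from_replicate_append) (auto simp: sum_list_halves sum_list_replicate)
      moreover have "sum_list ns = n" "length ns = k"
        unfolding ns using za n k \<open>z \<le> t\<close>
        by (auto simp: sum_list_halves sum_list_replicate length_halves)
      moreover have "\<forall>l\<in>set ns. 1 \<le> l \<and> l \<le> m"
        unfolding ns using le ge \<open>2 \<le> m\<close> by auto
      ultimately show ?thesis unfolding h by blast
    qed
  next
    case False
    have "a < 2 ^ (t + 1)" using False less_exp[of "t + 1"] by linarith
    then have h: "h = 1" unfolding assms(12) by simp
    obtain m' where m': "m = Suc m'" "0 < m'" using \<open>2 \<le> m\<close> by (cases m) auto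
    \<comment> \<open>Here \<open>n - k\<close> equals \<open>d * m'\<close> minus the positive
      number \<open>t + 2 - a\<close>; the inner equation is stated additively to avoid
      truncation.\<close>
    have "n - k < d * m'"
    proof -
      have "n + (t + 2 - a) = d * m' + k" using False n k m' by simp
      then show ?thesis using False assms(6) by linarith
    qed
    then have "\<beta> < d" unfolding assms(15) m' using m' by (simp add: less_mult_imp_div_less)
    have \<gamma>: "\<gamma> = (n - k) mod m'" unfolding assms(15,16) m' by (simp add: minus_mult_div_eq_mod)
    then have "\<gamma> < m'" using m' by simp
    \<comment> \<open>Starting from \<open>k\<close> ones, the surplus \<open>n - k\<close> raises
      \<open>\<beta>\<close> entries by \<open>m'\<close> and one further entry by
      \<open>\<gamma>\<close>.\<close>
    have nk: "n - k = \<beta> * m' + \<gamma>" unfolding \<gamma> assms(15) m' by simp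
    define c where "c = k - \<beta> - 1"
    \<comment> \<open>From \<open>\<beta> < d\<close> there are at least \<open>t + 2\<close>
      trailing ones, more than \<open>a\<close> and hence more than \<open>m\<close>, enough for
      both larger kinds of entries.\<close>
    have c: "k = \<beta> + 1 + c" "m < c" unfolding c_def using k \<open>\<beta> < d\<close> False a by auto
    have ns: "ns = replicate \<beta> m @ (\<gamma> + 1) # replicate c 1"
      unfolding assms(17) c_def using False by simp
    have "complete_from 1 ((\<gamma> + 1) # replicate c 1)"
      using complete_from_ones[of c] c \<open>\<gamma> < m'\<close> m' by (simp add: sum_list_replicate)
    then have "complete_from 1 ns"
      unfolding ns using c by (intro complete_from_replicate_append) (auto simp: sum_list_replicate)
    moreover have "sum_list ns = n" "length ns = k"
      unfolding ns using c nk m' assms(6) by (auto simp: sum_list_replicate)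
    moreover have "\<forall>l\<in>set ns. 1 \<le> l \<and> l \<le> m"
      unfolding ns using \<open>\<gamma> < m'\<close> m' by auto
    ultimately show ?thesis unfolding h by blast
  qed
  have "0 < h" unfolding assms(12) by simp
  with key have "is_code n k (block_code lam ns)"
    using is_code_block_code[of ns lam] by fastforce
  moreover have ws: "weight_spectrum K (block_code lam ns) = {h..m}"
    using key \<open>0 < h\<close> assms(7)
    by (intro weight_spectrum_block_code[OF assms(2,4,9)]) auto
  \<comment> \<open>Since \<open>k > 1\<close>, some block exists, and its length separates
    \<open>h\<close> from \<open>m\<close>; this justifies the natural subtraction in the
    cardinality.\<close>
  moreover have "h \<le> m"
    using key assms(5) by (cases ns) auto
  ultimately show ?thesis by (simp add: Suc_diff_le)
qed

end
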